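(* Let $G$ be a finite group with a cyclic Hall subgroup $H$ of order $n$. Let $\pi$ be the set of prime divisors of $n$, and for a $\pi$-element $x\in G$ let $\lambda_G(x)$ denote the number of Hall $\pi$-subgroups of $G$ containing $x$. Then \[\prod_{d\,\mid\, n}\Bigl(\prod_{x\in H}\lambda_G\bigl(x^{d}\bigr)^{\frac{n}{d}}\Bigr)^{\mu(d)}=1,\] where $d$ runs over the positive divisors of $n$ and $\mu$ is the (number-theoretic) Möbius function.
   Context: A Hall subgroup of a finite group $G$ is a subgroup $H$ such that $|H|$ and $|G:H|$ are coprime. For a set of primes $\pi$, a Hall $\pi$-subgroup of $G$ is a subgroup whose order is divisible only by primes in $\pi$ and whose index is divisible by no prime in $\pi$; when $\pi$ is the set of prime divisors of $n=|H|$ with $H$ a Hall subgroup, the Hall $\pi$-subgroups of $G$ are exactly the subgroups of $G$ of order $n$. A $\pi$-element is an element whose order is divisible only by primes in $\pi$. By a result of Wielandt, if $G$ has a cyclic Hall $\pi$-subgroup, then all Hall $\pi$-subgroups of $G$ are conjugate in $G$. The displayed product is an identity of positive rational numbers. *)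

theory Defs
  imports Complex_Main "HOL-Algebra.Elementary_Groups" "HOL-Computational_Algebra.Squarefree"
begin

definition hall_subgroup :: "'a set \<Rightarrow> ('a, 'b) monoid_scheme \<Rightarrow> bool" where
  "hall_subgroup H G \<longleftrightarrow>
     subgroup H G \<and> coprime (card H) (card (rcosets\<^bsub>G\<^esub> H))"

definition hall_pi_subgroup :: "nat set \<Rightarrow> 'a set \<Rightarrow> ('a, 'b) monoid_scheme \<Rightarrow> bool" where
  "hall_pi_subgroup \<pi> H G \<longleftrightarrow>
     subgroup H G \<and>
     (\<forall>p. Factorial_Ring.prime p \<longrightarrow> p dvd card H \<longrightarrow> p \<in> \<pi>) \<and>
     (\<forall>p. Factorial_Ring.prime p \<longrightarrow> p \<in> \<pi> \<longrightarrow> \<not> p dvd card (rcosets\<^bsub>G\<^esub> H))"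

(* Intended for finite G and x a pi-element of G; elsewhere the value is not meaningful
   (the cardinality of an infinite set is 0). *)
definition hall_count :: "('a, 'b) monoid_scheme \<Rightarrow> nat set \<Rightarrow> 'a \<Rightarrow> nat" where
  "hall_count G \<pi> x = card {K. hall_pi_subgroup \<pi> K G \<and> x \<in> K}"

definition moebius :: "nat \<Rightarrow> int" where
  "moebius n = (if squarefree n then (- 1) ^ card (prime_factors n) else 0)"

end

theory Submission
  imports Defs "HOL-Algebra.Multiplicative_Group"
begin

text \<open>
  Write \<open>H = \<langle>g\<rangle>\<close> and \<open>F j = \<lambda>(g\<^sup>j)\<close>. The map \<open>x \<mapsto> x\<^sup>d\<close> is \<open>d\<close>-to-one from \<open>H\<close> onto the powers
  \<open>g\<^sup>j\<close> with \<open>d\<close> dividing \<open>j\<close>, so the factor for \<open>d\<close> is the product of \<open>F j ^ (n * \<mu>(d))\<close> over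
  these \<open>j\<close>. Exchanging the products, \<open>F j\<close> acquires the exponent \<open>n\<close> times the sum of \<open>\<mu>(d)\<close>
  over the divisors \<open>d\<close> of \<open>gcd n j\<close>, which vanishes unless \<open>g\<^sup>j\<close> generates \<open>H\<close>. But a Hall
  \<open>\<pi>\<close>-subgroup has order \<open>n\<close>, so \<open>H\<close> is the only one that contains a generator of \<open>H\<close>.
\<close>

section \<open>Moebius sums over divisors\<close>

lemma moebius_prime_mult:
  assumes p: "Factorial_Ring.prime p" and d: "squarefree d" and pd: "\<not> p dvd d"
  shows "moebius (p * d) = - moebius d"
proof -
  have "coprime p d" using p pd by (simp add: prime_imp_coprime)
  then have "squarefree (p * d)"
    using d p by (simp add: squarefree_mult_coprime squarefree_prime)
  moreover have "d \<noteq> 0" using d by (metis not_squarefree_0)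
  then have "prime_factors (p * d) = insert p (prime_factors d)"
    using p by (auto simp: prime_factors_product prime_prime_factors)
  moreover have "p \<notin> prime_factors d" using pd by auto
  ultimately show ?thesis
    using d by (simp add: moebius_def)
qed

text \<open>Only squarefree divisors contribute. For a prime \<open>p\<close> dividing
  \<open>m\<close>, multiplication by \<open>p\<close> matches those prime to \<open>p\<close>
  (\<open>A\<close>) with those divisible by \<open>p\<close> (\<open>B\<close>) and reverses the
  sign, so the two partial sums cancel.\<close>

lemma sum_moebius_divisors:
  assumes "m > 0"
  shows "(\<Sum>d | d dvd m. moebius d) = (if m = 1 then 1 else 0)"
proof (cases "m = 1")
  case True
  then show ?thesis by (simp add: moebius_def)
next
  case False
  then obtain p where p: "Factorial_Ring.prime p" "p dvd m"
    using prime_factor_nat by blast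
  define S where "S = {d. d dvd m \<and> squarefree d}"
  define A where "A = {d \<in> S. \<not> p dvd d}"
  define B where "B = {d \<in> S. p dvd d}"
  have fin: "finite S" using assms by (simp add: S_def)
  have "B = (*) p ` A"
  proof
    show "B \<subseteq> (*) p ` A"
    proof
      fix x assume x: "x \<in> B"
      then obtain d where d: "x = p * d" by (auto simp: B_def)
      have sx: "squarefree x" "x dvd m" using x by (auto simp: B_def S_def)
      have "\<not> p dvd d"
      proof
        assume "p dvd d"
        then have "p\<^sup>2 dvd x" by (simp add: d power2_eq_square)
        then have "p dvd 1" using sx squarefreeD by blast
        then show False using p(1) by auto
      qed
      moreover have "squarefree d" "d dvd m"
        using sx by (auto simp: d dest: squarefree_multD dvd_mult_right)
      ultimately have "d \<in> A" by (simp add: A_def S_def)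
      then show "x \<in> (*) p ` A" unfolding d by (rule imageI)
    qed
    show "(*) p ` A \<subseteq> B"
    proof safe
      fix d assume "d \<in> A"
      then have d: "d dvd m" "squarefree d" "coprime p d"
        using p by (auto simp: A_def S_def prime_imp_coprime)
      then show "p * d \<in> B"
        using p by (simp add: B_def S_def divides_mult squarefree_mult_coprime squarefree_prime)
    qed
  qed
  moreover have "inj_on ((*) p) A" using p(1) by (auto simp: inj_on_def)
  ultimately have "sum moebius B = (\<Sum>d\<in>A. moebius (p * d))"
    by (simp add: sum.reindex)
  also have "\<dots> = (\<Sum>d\<in>A. - moebius d)"
    by (rule sum.cong) (auto simp: A_def S_def moebius_prime_mult p)
  finally have *: "sum moebius A + sum moebius B = 0"
    by (simp add: sum_negf)
  have "(\<Sum>d | d dvd m. moebius d) = sum moebius S"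
    unfolding S_def by (rule sum.mono_neutral_right) (use assms in \<open>auto simp: moebius_def\<close>)
  also have "S = A \<union> B" by (auto simp: A_def B_def)
  also have "sum moebius (A \<union> B) = sum moebius A + sum moebius B"
    by (rule sum.union_disjoint) (use fin in \<open>auto simp: A_def B_def\<close>)
  finally show ?thesis using * False by simp
qed

section \<open>Products of periodic functions\<close>

text \<open>With \<open>m = n / d\<close>, cut the range of \<open>k\<close> into \<open>d\<close>
  blocks of length \<open>m\<close>. Moving \<open>k\<close> by \<open>r * m\<close> moves
  \<open>k * d\<close> by \<open>r * n\<close>, a multiple of the period, so all blocks have the
  same product; the first one runs once through the multiples of \<open>d\<close> below
  \<open>n\<close>.\<close>

lemma prod_multiples_periodic:
  fixes f :: "nat \<Rightarrow> 'a::comm_monoid_mult"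
  assumes per: "\<And>k. f (k + n) = f k" and "d dvd n" "n > 0"
  shows "(\<Prod>k<n. f (k * d)) = (\<Prod>j | j < n \<and> d dvd j. f j) ^ d"
proof -
  obtain m where m: "n = d * m" using \<open>d dvd n\<close> by blast
  have "d > 0" using m \<open>n > 0\<close> by auto
  have per': "f (k + r * n) = f k" for k r
  proof (induction r)
    case (Suc r)
    then show ?case using per[of "k + r * n"] by (simp add: ac_simps)
  qed simp
  have "(\<Prod>k<n. f (k * d)) = (\<Prod>r<d. \<Prod>k\<in>{r * m..<r * m + m}. f (k * d))"
    by (simp add: prod.nat_group m)
  also have "\<dots> = (\<Prod>r<d. \<Prod>q<m. f (q * d))"
  proof (rule prod.cong [OF refl])
    fix r
    have "(\<Prod>k\<in>{r * m..<r * m + m}. f (k * d)) = (\<Prod>q<m. f ((q + r * m) * d))"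
      using prod.shift_bounds_nat_ivl[of "\<lambda>k. f (k * d)" 0 "r * m" m]
      by (simp add: atLeast0LessThan add.commute)
    also have "\<dots> = (\<Prod>q<m. f (q * d))"
    proof (rule prod.cong [OF refl])
      fix q
      show "f ((q + r * m) * d) = f (q * d)"
        using per'[of "q * d" r] by (simp add: m algebra_simps)
    qed
    finally show "(\<Prod>k\<in>{r * m..<r * m + m}. f (k * d)) = (\<Prod>q<m. f (q * d))" .
  qed
  also have "\<dots> = (\<Prod>q<m. f (q * d)) ^ d" by simp
  also have "(\<Prod>q<m. f (q * d)) = (\<Prod>j | j < n \<and> d dvd j. f j)"
    by (rule prod.reindex_bij_witness[of _ "\<lambda>j. j div d" "\<lambda>q. q * d"])
      (use \<open>d > 0\<close> in \<open>auto simp: m mult.commute less_mult_imp_div_less\<close>)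
  finally show ?thesis .
qed

lemma power_int_sum:
  fixes c :: "'a::field"
  assumes "c \<noteq> 0"
  shows "c powi (\<Sum>d\<in>D. f d) = (\<Prod>d\<in>D. c powi f d)"
  by (induction D rule: infinite_finite_induct) (auto simp: power_int_add assms)

lemma prod_power_int_distrib:
  fixes f :: "'b \<Rightarrow> 'a::field"
  shows "(\<Prod>j\<in>J. f j) powi k = (\<Prod>j\<in>J. f j powi k)"
  by (induction J rule: infinite_finite_induct) (auto simp: power_int_mult_distrib)

text \<open>The group-free core, to be applied to the counts along the powers of a generator. Values
  must be nonzero because exponents of both signs are added.\<close>

lemma prod_power_moebius_periodic:
  fixes f :: "nat \<Rightarrow> 'a::field"
  assumes per: "\<And>k. f (k + n) = f k" and nz: "\<And>k. f k \<noteq> 0" and "n > 0"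
  shows "(\<Prod>d | d dvd n. (\<Prod>k<n. f (k * d) ^ (n div d)) powi moebius d)
       = (\<Prod>j | j < n \<and> coprime n j. f j) ^ n"
proof -
  \<comment> \<open>Extending the exponent by 0 lets every inner product run over all
    \<open>j < n\<close>, independently of \<open>d\<close>, so that the products can be
    exchanged.\<close>
  let ?c = "\<lambda>d j. if d dvd j then moebius d else 0"
  have fin: "finite {d. d dvd n}" using \<open>n > 0\<close> by simp
  have "(\<Prod>k<n. f (k * d) ^ (n div d)) powi moebius d = (\<Prod>j<n. (f j ^ n) powi ?c d j)"
    if "d dvd n" for d
  proof -
    \<comment> \<open>The multiplicity \<open>d\<close> and the weight \<open>n div d\<close>
      combine to an exponent that no longer depends on \<open>d\<close>.\<close>
    have "(\<Prod>k<n. f (k * d) ^ (n div d)) = (\<Prod>j | j < n \<and> d dvd j. f j) ^ (d * (n div d))"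
      using prod_multiples_periodic[of f n d] per that \<open>n > 0\<close>
      by (simp flip: power_mult prod_power_distrib)
    also have "\<dots> = (\<Prod>j | j < n \<and> d dvd j. f j ^ n)"
      using that by (simp add: prod_power_distrib)
    finally have "(\<Prod>k<n. f (k * d) ^ (n div d)) powi moebius d
        = (\<Prod>j | j < n \<and> d dvd j. (f j ^ n) powi moebius d)"
      by (simp add: prod_power_int_distrib)
    also have "\<dots> = (\<Prod>j<n. (f j ^ n) powi ?c d j)"
      by (rule prod.mono_neutral_cong_left) auto
    finally show ?thesis .
  qed
  then have "(\<Prod>d | d dvd n. (\<Prod>k<n. f (k * d) ^ (n div d)) powi moebius d)
      = (\<Prod>d | d dvd n. \<Prod>j<n. (f j ^ n) powi ?c d j)"
    by (intro prod.cong) auto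
  also have "\<dots> = (\<Prod>j<n. (f j ^ n) powi (\<Sum>d | d dvd n. ?c d j))"
    by (subst prod.swap) (simp add: power_int_sum nz)
  also have "\<dots> = (\<Prod>j<n. if coprime n j then f j ^ n else 1)"
  proof (rule prod.cong [OF refl])
    fix j
    \<comment> \<open>The divisors of \<open>n\<close> with nonzero \<open>?c d j\<close> all divide
      \<open>j\<close>, hence \<open>gcd n j\<close>.\<close>
    have "(\<Sum>d | d dvd n. ?c d j) = (\<Sum>d | d dvd gcd n j. moebius d)"
      by (rule sum.mono_neutral_cong_right) (use fin in auto)
    also have "\<dots> = (if coprime n j then 1 else 0)"
      using sum_moebius_divisors[of "gcd n j"] \<open>n > 0\<close> by (simp add: coprime_iff_gcd_eq_1)
    finally show "(f j ^ n) powi (\<Sum>d | d dvd n. ?c d j) = (if coprime n j then f j ^ n else 1)"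
      by simp
  qed
  also have "\<dots> = (\<Prod>j | j < n \<and> coprime n j. f j ^ n)"
    by (rule prod.mono_neutral_cong_right) auto
  finally show ?thesis by (simp add: prod_power_distrib)
qed

section \<open>Hall subgroups and powers of a generator\<close>

context group
begin

text \<open>By Lagrange, order times index is the same for \<open>H\<close> and \<open>K\<close>.
  The order of each is coprime to the index of the other, hence divides the order of the
  other.\<close>

lemma hall_pi_subgroup_card:
  assumes fin: "finite (carrier G)" and H: "hall_subgroup H G"
    and K: "hall_pi_subgroup (prime_factors (card H)) K G"
  shows "card K = card H"
proof (rule dvd_antisym)
  have sub: "subgroup H G" "subgroup K G"
    using H K by (auto simp: hall_subgroup_def hall_pi_subgroup_def)
  then have pos: "card H > 0" "card K > 0"
    using fin by (auto intro: subgroup.finite_imp_card_positive)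
  have eq: "card (rcosets K) * card K = card (rcosets H) * card H"
    using sub by (simp add: lagrange)
  have "coprime (card K) (card (rcosets H))"
  proof (rule ccontr)
    assume "\<not> coprime (card K) (card (rcosets H))"
    then obtain p where p: "Factorial_Ring.prime p" "p dvd card K" "p dvd card (rcosets H)"
      by (metis coprime_iff_gcd_eq_1 gcd_nat.boundedE prime_factor_nat)
    then have "p dvd card H"
      using K by (auto simp: hall_pi_subgroup_def)
    then have "is_unit p"
      using p(3) H coprime_common_divisor[of "card H" "card (rcosets H)" p] by (auto simp: hall_subgroup_def)
    then show False using p(1) by auto
  qed
  then show "card K dvd card H"
    by (metis eq coprime_dvd_mult_right_iff dvd_triv_right)
  have "coprime (card H) (card (rcosets K))"
  proof (rule ccontr)
    assume "\<not> coprime (card H) (card (rcosets K))"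
    then obtain p where p: "Factorial_Ring.prime p" "p dvd card H" "p dvd card (rcosets K)"
      by (metis coprime_iff_gcd_eq_1 gcd_nat.boundedE prime_factor_nat)
    then have "p \<in> prime_factors (card H)"
      using pos by (simp add: prime_factors_dvd)
    then show False
      using p K by (auto simp: hall_pi_subgroup_def)
  qed
  then show "card H dvd card K"
    by (metis eq coprime_dvd_mult_right_iff dvd_triv_right)
qed

lemma hall_subgroup_imp_hall_pi_subgroup:
  assumes fin: "finite (carrier G)" and H: "hall_subgroup H G"
  shows "hall_pi_subgroup (prime_factors (card H)) H G"
proof -
  have sub: "subgroup H G" using H by (simp add: hall_subgroup_def)
  have "card H > 0"
    using fin sub by (auto intro: subgroup.finite_imp_card_positive)
  have "\<not> p dvd card (rcosets H)" if "Factorial_Ring.prime p" "p dvd card H" for p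
    using that H coprime_common_divisor[of "card H" "card (rcosets H)" p]
    by (auto simp: hall_subgroup_def)
  then show ?thesis
    using sub \<open>card H > 0\<close> by (auto simp: hall_pi_subgroup_def prime_factors_dvd)
qed

lemma cyclic_subgroup_generator:
  assumes sub: "subgroup H G" and cyc: "cyclic_group (G\<lparr>carrier := H\<rparr>)"
  obtains g where "g \<in> H" "H = generate G {g}"
proof -
  interpret H: group "G\<lparr>carrier := H\<rparr>" using sub by (rule subgroup_imp_group)
  obtain g where g: "g \<in> H" "H = range (\<lambda>k::int. g [^]\<^bsub>G\<lparr>carrier := H\<rparr>\<^esub> k)"
    using cyc by (auto simp: H.cyclic_group)
  then have "H = generate G {g}"
    using sub by (auto simp: generate_pow subgroup.mem_carrier int_pow_consistent[symmetric])
  with g show thesis by (rule_tac that)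
qed

lemma subgroup_nat_pow_closed:
  assumes "subgroup K G" "x \<in> K"
  shows "x [^] (k::nat) \<in> K"
  by (induction k) (use assms in \<open>auto simp: subgroup.one_closed subgroup.m_closed\<close>)

lemma generate_nat_pow_bij_betw:
  assumes fin: "finite (carrier G)" and g: "g \<in> carrier G"
  shows "bij_betw (\<lambda>k::nat. g [^] k) {..<ord g} (generate G {g})"
proof -
  have o: "ord g \<noteq> 0" using ord_ge_1[OF fin g] by simp
  have set_eq: "{0..ord g - 1} = {..<ord g}" using o by auto
  have "generate G {g} = {g [^] k |k. k \<in> (UNIV :: nat set)}"
    using generate_pow_nat[OF g o] .
  also have "\<dots> = (\<lambda>k::nat. g [^] k) ` {..<ord g}"
    unfolding ord_elems[OF fin g] set_eq by auto
  finally show ?thesis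
    using ord_inj[OF g] unfolding set_eq by (simp add: bij_betw_def)
qed

text \<open>Bezout gives an exponent \<open>a\<close> with \<open>(g [^] j) [^] a = g\<close>. For
  \<open>j = 0\<close>, where \<open>bezout_nat\<close> does not apply, coprimality forces
  \<open>g\<close> to be trivial.\<close>

lemma nat_pow_coprime_generates:
  assumes K: "subgroup K G" and g: "g \<in> carrier G"
    and cop: "coprime (ord g) j" and mem: "g [^] j \<in> K"
  shows "g \<in> K"
proof (cases "j = 0")
  case True
  then have "ord g = 1" using cop by simp
  then have "g = \<one>"
    using pow_ord_eq_1[OF g] g by (simp del: pow_ord_eq_1)
  then show ?thesis
    using mem True by simp
next
  case False
  then obtain a b where "j * a = ord g * b + 1"
    using bezout_nat[of j "ord g"] cop by (auto simp: coprime_iff_gcd_eq_1 gcd.commute)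
  then have "(g [^] j) [^] a = (g [^] ord g) [^] b \<otimes> g"
    using g by (simp add: nat_pow_pow del: pow_ord_eq_1)
  then have "(g [^] j) [^] a = g"
    using g by (simp add: nat_pow_one)
  then show ?thesis
    using subgroup_nat_pow_closed[OF K mem, of a] by simp
qed

end

theorem proposition4:
  fixes G (structure) and H :: "'a set" and n :: nat and \<pi> :: "nat set"
  assumes "group G" and "finite (carrier G)"
    and "hall_subgroup H G"
    and "cyclic_group (G\<lparr>carrier := H\<rparr>)"
    and "card H = n"
    and "\<pi> = prime_factors n"
  shows "(\<Prod>d | d dvd n. (\<Prod>x\<in>H. rat_of_nat (hall_count G \<pi> (x [^] d)) ^ (n div d)) powi moebius d) = 1"
proof -
  interpret group G by fact
  note fin = \<open>finite (carrier G)\<close>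
  have sub: "subgroup H G" using assms(3) by (simp add: hall_subgroup_def)
  obtain g where gH: "g \<in> H" and H: "H = generate G {g}"
    using cyclic_subgroup_generator[OF sub assms(4)] .
  have g: "g \<in> carrier G" using gH sub by (rule subgroup.mem_carrier[rotated])
  have n: "n = ord g" using generate_pow_card[OF g] H assms(5) by simp
  have "n > 0" using ord_ge_1[OF fin g] n by simp
  define f where "f j = rat_of_nat (hall_count G \<pi> (g [^] j))" for j :: nat
  have hallH: "hall_pi_subgroup \<pi> H G"
    using hall_subgroup_imp_hall_pi_subgroup[OF fin assms(3)] assms(5,6) by simp
  \<comment> \<open>Such a \<open>K\<close> contains the group generated by \<open>g\<close>, which
    is \<open>H\<close>, and has the same finite order.\<close>
  have hall_eq: "K = H" if K: "hall_pi_subgroup \<pi> K G" and gK: "g \<in> K" for K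
  proof -
    have "subgroup K G" using K by (simp add: hall_pi_subgroup_def)
    then have "H \<subseteq> K" using gK by (simp add: H generate_subgroup_incl)
    moreover have "card K = card H"
      using hall_pi_subgroup_card[OF fin assms(3)] K assms(5,6) by simp
    moreover have "finite K"
      using \<open>subgroup K G\<close> fin subgroup.subset finite_subset by blast
    ultimately show ?thesis by (metis card_subset_eq)
  qed
  have per: "f (k + n) = f k" for k
    using g by (simp add: f_def n pow_ord_eq_1 flip: nat_pow_mult)
  \<comment> \<open>\<open>H\<close> itself is counted. Finiteness matters, as an infinite set would
    have cardinality 0.\<close>
  have nz: "f k \<noteq> 0" for k
  proof -
    have "finite {K. hall_pi_subgroup \<pi> K G \<and> g [^] k \<in> K}"
      by (rule finite_subset[of _ "Pow (carrier G)"])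
        (use fin in \<open>auto simp: hall_pi_subgroup_def dest: subgroup.mem_carrier\<close>)
    moreover have "g [^] k \<in> H" using sub gH by (rule subgroup_nat_pow_closed)
    ultimately show ?thesis
      using hallH by (auto simp: f_def hall_count_def)
  qed
  have gen: "f j = 1" if "coprime n j" for j
  proof -
    have "{K. hall_pi_subgroup \<pi> K G \<and> g [^] j \<in> K} = {H}"
    proof -
      have "K = H" if K: "hall_pi_subgroup \<pi> K G" "g [^] j \<in> K" for K
      proof -
        have "subgroup K G" using K by (simp add: hall_pi_subgroup_def)
        then have "g \<in> K"
          using nat_pow_coprime_generates[OF _ g] K(2) \<open>coprime n j\<close> n by blast
        then show ?thesis using hall_eq K by blast
      qed
      then show ?thesis
        using hallH subgroup_nat_pow_closed[OF sub gH] by blast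
    qed
    then show ?thesis by (simp add: f_def hall_count_def)
  qed
  \<comment> \<open>Substitute \<open>x = g [^] k\<close> with \<open>k < n\<close>, so that
    \<open>x [^] d\<close> becomes \<open>g [^] (k * d)\<close>.\<close>
  have "(\<Prod>x\<in>H. rat_of_nat (hall_count G \<pi> (x [^] d)) ^ (n div d))
      = (\<Prod>k<n. f (k * d) ^ (n div d))" for d :: nat
    using g by (subst prod.reindex_bij_betw[OF generate_nat_pow_bij_betw[OF fin g],
          folded H n, symmetric]) (simp add: f_def nat_pow_pow)
  then have "(\<Prod>d | d dvd n. (\<Prod>x\<in>H. rat_of_nat (hall_count G \<pi> (x [^] d)) ^ (n div d)) powi moebius d)
      = (\<Prod>j | j < n \<and> coprime n j. f j) ^ n"
    using prod_power_moebius_periodic[of f n] per nz \<open>n > 0\<close> by simp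
  also have "\<dots> = 1" by (simp add: gen)
  finally show ?thesis .
qed

end
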